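(* Suppose $0< \alpha < \beta \leq 1$ are rational numbers. Then $\mathrm{SC}(\lambda n.\, n^\alpha) \leq_{\mathrm{s}} \mathrm{COMPLEX}(\lambda n.\, n^\beta)$.
   Context: Prefix-free complexity: a prefix-free machine is a partial recursive $M$ from $\{0,1\}^*$ to $\{0,1\}^*$ with prefix-free domain; $U$ is universal if for each prefix-free machine $M$ there is $\rho$ with $U(\rho^\frown\tau)\simeq M(\tau)$ for all $\tau$. Fix a universal $U$ and let $K(\sigma)=\min\{|\tau| : U(\tau)=\sigma\}$. For $f\colon\mathbb{N}\to\mathbb{R}$, $\mathrm{COMPLEX}(f)$ is the set of $X\in\{0,1\}^{\mathbb{N}}$ for which there is $c\in\mathbb{N}$ with $K(X\upharpoonright n)\geq f(n)-c$ for all $n$; $\mathrm{SC}(f)$ is the set of $X\in\{0,1\}^{\mathbb{N}}$ for which there is $c\in\mathbb{N}$ with $K(\tau)\geq f(|\tau|)-c$ for every (contiguous, finite) substring $\tau$ of $X$. For $P,Q\subseteq\mathbb{N}^{\mathbb{N}}$, $P\leq_{\mathrm{s}}Q$ means there is a partial recursive functional defined on all of $Q$ that maps $Q$ into $P$. *)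

theory Defs
  imports Complex_Main "HOL-Library.Sublist"
begin

section \<open>Partial recursive functions and functionals\<close>

text \<open>
  Kleene's schemata, extended by a basic scheme \<open>Query\<close> that evaluates a function
  argument \<open>X\<close> of type \<open>nat \<Rightarrow> nat\<close>. The relation \<open>computes X e xs y\<close> says that the
  program \<open>e\<close> halts with value \<open>y\<close> on input \<open>xs\<close> when given \<open>X\<close>. Arities are not
  tracked: a program applied to a list of unsuitable length diverges or ignores the
  surplus arguments, so for each fixed number of arguments exactly the usual functions arise.
\<close>

datatype program =
    Zero
  | Succ
  | Proj nat
  | Query
  | Comp program "program list"
  | PrimRec program program
  | Mu program

inductive computes :: "(nat \<Rightarrow> nat) \<Rightarrow> program \<Rightarrow> nat list \<Rightarrow> nat \<Rightarrow> bool"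
  for X :: "nat \<Rightarrow> nat" where
  Zero: "computes X Zero xs 0"
| Succ: "computes X Succ [x] (Suc x)"
| Proj: "i < length xs \<Longrightarrow> computes X (Proj i) xs (xs ! i)"
| Query: "computes X Query [x] (X x)"
| Comp: "list_all2 (\<lambda>g y. computes X g xs y) gs ys \<Longrightarrow> computes X f ys z
    \<Longrightarrow> computes X (Comp f gs) xs z"
| PrimRec_0: "computes X f xs y \<Longrightarrow> computes X (PrimRec f g) (0 # xs) y"
| PrimRec_Suc: "computes X (PrimRec f g) (n # xs) y \<Longrightarrow> computes X g (n # y # xs) z
    \<Longrightarrow> computes X (PrimRec f g) (Suc n # xs) z"
| Mu: "computes X f (n # xs) 0 \<Longrightarrow> (\<forall>m<n. \<exists>y. computes X f (m # xs) (Suc y))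
    \<Longrightarrow> computes X (Mu f) xs n"

inductive_cases computes_ZeroE: "computes X Zero xs y"
inductive_cases computes_SuccE: "computes X Succ xs y"
inductive_cases computes_ProjE: "computes X (Proj i) xs y"
inductive_cases computes_QueryE: "computes X Query xs y"
inductive_cases computes_CompE: "computes X (Comp f gs) xs y"
inductive_cases computes_PrimRec_0E: "computes X (PrimRec f g) (0 # xs) y"
inductive_cases computes_PrimRec_SucE: "computes X (PrimRec f g) (Suc n # xs) y"
inductive_cases computes_MuE: "computes X (Mu f) xs y"

lemma computes_deterministic:
  "computes X e xs y \<Longrightarrow> computes X e xs z \<Longrightarrow> y = z"
proof (induction arbitrary: z rule: computes.induct)
  case (Zero xs)
  then show ?case by (rule computes_ZeroE) simp
next
  case (Succ x)
  then show ?case by (rule computes_SuccE) simp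
next
  case (Proj i xs)
  from Proj.prems show ?case by (rule computes_ProjE) simp
next
  case (Query x)
  then show ?case by (rule computes_QueryE) simp
next
  case (Comp xs gs ys f w)
  from Comp.prems obtain ys' where ys': "list_all2 (\<lambda>g y. computes X g xs y) gs ys'"
    and f: "computes X f ys' z"
    by (rule computes_CompE)
  have unique: "list_all2 (\<lambda>g y. computes X g xs y \<and> (\<forall>z. computes X g xs z \<longrightarrow> y = z)) gs us
      \<Longrightarrow> list_all2 (\<lambda>g y. computes X g xs y) gs vs \<Longrightarrow> us = vs" for us vs
  proof (induction gs arbitrary: us vs)
    case Nil
    then show ?case by simp
  next
    case (Cons g gs)
    from Cons.prems(1) obtain u us' where us: "us = u # us'"
      and u: "\<forall>z. computes X g xs z \<longrightarrow> u = z"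
      and us': "list_all2 (\<lambda>g y. computes X g xs y \<and> (\<forall>z. computes X g xs z \<longrightarrow> y = z)) gs us'"
      unfolding list_all2_Cons1 by blast
    from Cons.prems(2) obtain v vs' where vs: "vs = v # vs'"
      and v: "computes X g xs v" and vs': "list_all2 (\<lambda>g y. computes X g xs y) gs vs'"
      unfolding list_all2_Cons1 by blast
    have "u = v" using u v by blast
    moreover have "us' = vs'" using us' vs' by (rule Cons.IH)
    ultimately show ?case using us vs by simp
  qed
  have "ys = ys'" using Comp.IH(1) ys' by (rule unique)
  with f have "computes X f ys z" by simp
  then show ?case by (rule Comp.IH(2))
next
  case (PrimRec_0 f xs y g)
  from PrimRec_0.prems have "computes X f xs z" by (rule computes_PrimRec_0E)
  then show ?case by (rule PrimRec_0.IH)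
next
  case (PrimRec_Suc f g n xs y w)
  from PrimRec_Suc.prems obtain y' where "computes X (PrimRec f g) (n # xs) y'"
    and "computes X g (n # y' # xs) z"
    by (rule computes_PrimRec_SucE)
  with PrimRec_Suc.IH show ?case by blast
next
  case (Mu f n xs)
  from Mu.prems have z: "computes X f (z # xs) 0"
    and below: "\<forall>m<z. \<exists>y. computes X f (m # xs) (Suc y)"
    by (blast elim: computes_MuE)+
  show ?case
  proof (rule linorder_cases[of n z])
    assume "n < z"
    with below obtain y where "computes X f (n # xs) (Suc y)" by blast
    then have "0 = Suc y" by (rule Mu.IH(1))
    then show ?thesis by simp
  next
    assume "z < n"
    with Mu.IH(2) obtain y where "\<forall>x. computes X f (z # xs) x \<longrightarrow> Suc y = x" by blast
    with z show ?thesis by fastforce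
  qed simp
qed

fun query_free :: "program \<Rightarrow> bool" where
  "query_free Query = False"
| "query_free (Comp f gs) = (query_free f \<and> (\<forall>g \<in> set gs. query_free g))"
| "query_free (PrimRec f g) = (query_free f \<and> query_free g)"
| "query_free (Mu f) = query_free f"
| "query_free _ = True"

text \<open>
  A partial functional from \<open>nat \<Rightarrow> nat\<close> to \<open>nat \<Rightarrow> nat\<close> is defined at \<open>X\<close> iff the
  program produces a value at every number.
\<close>

definition partial_recursive_functional ::
    "((nat \<Rightarrow> nat) \<Rightarrow> (nat \<Rightarrow> nat) option) \<Rightarrow> bool" where
  "partial_recursive_functional \<Phi> \<longleftrightarrow>
     (\<exists>e. \<forall>X Y. \<Phi> X = Some Y \<longleftrightarrow> (\<forall>n. computes X e [n] (Y n)))"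

definition strongly_reducible :: "(nat \<Rightarrow> nat) set \<Rightarrow> (nat \<Rightarrow> nat) set \<Rightarrow> bool"
    (infix "\<le>\<^sub>s" 50) where
  "P \<le>\<^sub>s Q \<longleftrightarrow>
     (\<exists>\<Phi>. partial_recursive_functional \<Phi> \<and> (\<forall>X\<in>Q. \<exists>Y\<in>P. \<Phi> X = Some Y))"

section \<open>Prefix-free machines and complexity\<close>

text \<open>Strings are identified with numbers by bijective binary numeration, first bit least significant.\<close>

primrec str_code :: "bool list \<Rightarrow> nat" where
  "str_code [] = 0"
| "str_code (b # s) = 2 * str_code s + (if b then 2 else 1)"

lemma bij_str_code: "bij str_code"
proof (rule bijI)
  have "str_code s = str_code t \<Longrightarrow> s = t" for s t
  proof (induction s arbitrary: t)
    case Nil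
    then show ?case by (cases t) (simp_all split: if_splits)
  next
    case (Cons b s)
    then obtain c t' where t: "t = c # t'" by (cases t) (simp_all split: if_splits)
    with Cons.prems have eq: "2 * str_code s + (if b then 2 else 1)
        = 2 * str_code t' + (if c then 2 else 1)" by simp
    then have "b = c" by (cases b; cases c; simp; presburger)
    with eq have "str_code s = str_code t'" by simp
    with Cons.IH \<open>b = c\<close> t show ?case by simp
  qed
  then show "inj str_code" by (rule injI)
  have "\<exists>s. str_code s = n" for n
  proof (induction n rule: less_induct)
    case (less n)
    have "n = 0 \<or> (\<exists>k. n = 2 * k + 1) \<or> (\<exists>k. n = 2 * k + 2)"
      by presburger
    then consider "n = 0" | k where "n = 2 * k + 1" | k where "n = 2 * k + 2"
      by blast
    then show ?case
    proof cases
      case 1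
      then show ?thesis by (intro exI[of _ "[]"]) simp
    next
      case (2 k)
      then have "k < n" by simp
      with less obtain s where "str_code s = k" by blast
      with 2 show ?thesis by (intro exI[of _ "False # s"]) simp
    next
      case (3 k)
      then have "k < n" by simp
      with less obtain s where "str_code s = k" by blast
      with 3 show ?thesis by (intro exI[of _ "True # s"]) simp
    qed
  qed
  then show "surj str_code" by (simp add: surj_def) metis
qed

definition partial_recursive_on_strings :: "(bool list \<Rightarrow> bool list option) \<Rightarrow> bool" where
  "partial_recursive_on_strings M \<longleftrightarrow>
     (\<exists>e. query_free e \<and>
       (\<forall>X \<sigma> \<tau>. M \<sigma> = Some \<tau> \<longleftrightarrow> computes X e [str_code \<sigma>] (str_code \<tau>)))"

definition prefix_free :: "bool list set \<Rightarrow> bool" where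
  "prefix_free A \<longleftrightarrow> (\<forall>\<sigma>\<in>A. \<forall>\<tau>\<in>A. prefix \<sigma> \<tau> \<longrightarrow> \<sigma> = \<tau>)"

definition prefix_free_machine :: "(bool list \<Rightarrow> bool list option) \<Rightarrow> bool" where
  "prefix_free_machine M \<longleftrightarrow> partial_recursive_on_strings M \<and> prefix_free (dom M)"

definition universal :: "(bool list \<Rightarrow> bool list option) \<Rightarrow> bool" where
  "universal U \<longleftrightarrow> prefix_free_machine U \<and>
     (\<forall>M. prefix_free_machine M \<longrightarrow> (\<exists>\<rho>. \<forall>\<tau>. U (\<rho> @ \<tau>) = M \<tau>))"

definition K :: "(bool list \<Rightarrow> bool list option) \<Rightarrow> bool list \<Rightarrow> nat" where
  "K U \<sigma> = (LEAST n. \<exists>\<tau>. length \<tau> = n \<and> U \<tau> = Some \<sigma>)"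

section \<open>Complex and shift-complex sequences\<close>

definition restr :: "(nat \<Rightarrow> bool) \<Rightarrow> nat \<Rightarrow> bool list" where
  "restr X n = map X [0..<n]"

definition substring_of :: "bool list \<Rightarrow> (nat \<Rightarrow> bool) \<Rightarrow> bool" where
  "substring_of \<tau> X \<longleftrightarrow> (\<exists>i j. \<tau> = map X [i..<j])"

definition COMPLEX ::
    "(bool list \<Rightarrow> bool list option) \<Rightarrow> (nat \<Rightarrow> real) \<Rightarrow> (nat \<Rightarrow> bool) set" where
  "COMPLEX U f = {X. \<exists>c::nat. \<forall>n. real (K U (restr X n)) \<ge> f n - real c}"

definition SC ::
    "(bool list \<Rightarrow> bool list option) \<Rightarrow> (nat \<Rightarrow> real) \<Rightarrow> (nat \<Rightarrow> bool) set" where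
  "SC U f = {X. \<exists>c::nat. \<forall>\<tau>. substring_of \<tau> X \<longrightarrow>
      real (K U \<tau>) \<ge> f (length \<tau>) - real c}"

text \<open>The inclusion of Cantor space into Baire space, on sets.\<close>

definition in_Baire :: "(nat \<Rightarrow> bool) set \<Rightarrow> (nat \<Rightarrow> nat) set" where
  "in_Baire A = (\<lambda>X n. of_bool (X n)) ` A"

end

theory Submission
  imports Defs
begin

text \<open>
  Fix \<open>q\<close> with \<open>(q + 1) * \<alpha> < q * \<beta>\<close> and write \<open>p + 1 = 2 ^ v * (2 * t + 1)\<close>. Let \<open>Y\<close> have at
  position \<open>p\<close> the bit of \<open>X\<close> with index \<open>t mod 2 ^ (q * v)\<close>. Every window of \<open>Y\<close> of length
  \<open>n \<ge> 2 ^ ((q + 1) * v + 1)\<close> then contains the first \<open>2 ^ (q * v)\<close> bits of \<open>X\<close>, and they can be read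
  off given \<open>v\<close> and the position of the window modulo \<open>2 ^ ((q + 1) * v + 1)\<close>. For the largest such
  \<open>v\<close> the prefix of \<open>X\<close> has length of order \<open>n powr (q / (q + 1))\<close>, so its complexity is at least of
  order \<open>n powr (q * \<beta> / (q + 1))\<close>, which beats \<open>n powr \<alpha>\<close> even after paying \<open>O(log n)\<close> bits for \<open>v\<close>
  and the position.
\<close>

section \<open>Closure properties of the partial recursive functions\<close>

text \<open>Quantifying over all \<open>X\<close> matches
  \<open>partial_recursive_on_strings\<close>; the equivalence also records where the program
  diverges.\<close>

definition partrec :: "nat \<Rightarrow> (nat list \<Rightarrow> nat option) \<Rightarrow> bool" where
  "partrec k f \<longleftrightarrow> (\<exists>e. query_free e \<and>
     (\<forall>X xs y. length xs = k \<longrightarrow> (computes X e xs y \<longleftrightarrow> f xs = Some y)))"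

text \<open>One implication suffices, as determinism of \<open>computes\<close> excludes any other
  value.\<close>

definition totrec :: "nat \<Rightarrow> (nat list \<Rightarrow> nat) \<Rightarrow> bool" where
  "totrec k f \<longleftrightarrow> (\<exists>e. query_free e \<and> (\<forall>X xs. length xs = k \<longrightarrow> computes X e xs (f xs)))"

lemma partrec_if_totrec: "totrec k f \<Longrightarrow> partrec k (\<lambda>xs. Some (f xs))"
  unfolding totrec_def partrec_def by (metis computes_deterministic option.inject)

lemma totrec_cong:
  assumes "totrec k f" and "\<And>xs. length xs = k \<Longrightarrow> f xs = g xs"
  shows "totrec k g"
  using assms unfolding totrec_def by auto

lemma totrec_Zero: "totrec k (\<lambda>xs. 0)"
  unfolding totrec_def by (intro exI[of _ Zero]) (simp add: computes.Zero)

lemma totrec_Proj: "i < k \<Longrightarrow> totrec k (\<lambda>xs. xs ! i)"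
  unfolding totrec_def by (intro exI[of _ "Proj i"]) (simp add: computes.Proj)

lemma totrec_Comp:
  assumes "totrec (length gs) f" and "\<forall>g \<in> set gs. totrec k g"
  shows "totrec k (\<lambda>xs. f (map (\<lambda>g. g xs) gs))"
proof -
  obtain e where e: "query_free e"
    "\<And>X xs. length xs = length gs \<Longrightarrow> computes X e xs (f xs)"
    using assms(1) unfolding totrec_def by blast
  obtain E where E: "\<And>g. g \<in> set gs \<Longrightarrow> query_free (E g)"
    "\<And>g X xs. g \<in> set gs \<Longrightarrow> length xs = k \<Longrightarrow> computes X (E g) xs (g xs)"
    using assms(2) unfolding totrec_def by metis
  have "computes X (Comp e (map E gs)) xs (f (map (\<lambda>g. g xs) gs))" if "length xs = k" for X xs
    using that E(2) e(2)
    by (intro computes.Comp[where ys = "map (\<lambda>g. g xs) gs"])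
      (auto simp: list_all2_map1 list_all2_map2 intro: list.rel_refl_strong)
  then show ?thesis
    unfolding totrec_def using e(1) E(1) by (intro exI[of _ "Comp e (map E gs)"]) auto
qed

lemma totrec_comp1:
  assumes "totrec 1 (\<lambda>xs. F (xs ! 0))" and "totrec k f"
  shows "totrec k (\<lambda>xs. F (f xs))"
  using totrec_Comp[of "[f]" "\<lambda>xs. F (xs ! 0)" k] assms by simp

lemma totrec_comp2:
  assumes "totrec 2 (\<lambda>xs. F (xs ! 0) (xs ! 1))" and "totrec k f" and "totrec k g"
  shows "totrec k (\<lambda>xs. F (f xs) (g xs))"
  using totrec_Comp[of "[f, g]" "\<lambda>xs. F (xs ! 0) (xs ! 1)" k] assms by (simp add: numeral_2_eq_2)

lemma totrec_Suc: assumes "totrec k f" shows "totrec k (\<lambda>xs. Suc (f xs))"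
proof -
  have "totrec 1 (\<lambda>xs. Suc (xs ! 0))"
    unfolding totrec_def by (intro exI[of _ Succ]) (auto simp: length_Suc_conv computes.Succ)
  then show ?thesis using assms by (rule totrec_comp1)
qed

lemma totrec_const: "totrec k (\<lambda>xs. n)"
  by (induction n) (simp_all add: totrec_Zero totrec_Suc)

text \<open>Composing \<open>PrimRec\<close> with \<open>h\<close> and all \<open>k\<close>
  projections lets the recursion run up to a computed value while the whole list \<open>xs\<close>
  stays available as parameters.\<close>

lemma totrec_PrimRec:
  assumes "totrec k f" and "totrec (Suc (Suc k)) g" and "totrec k h"
  shows "totrec k (\<lambda>xs. rec_nat (f xs) (\<lambda>n y. g (n # y # xs)) (h xs))"
proof -
  obtain ef where ef: "query_free ef" "\<And>X xs. length xs = k \<Longrightarrow> computes X ef xs (f xs)"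
    using assms(1) unfolding totrec_def by blast
  obtain eg where eg: "query_free eg"
    "\<And>X xs. length xs = Suc (Suc k) \<Longrightarrow> computes X eg xs (g xs)"
    using assms(2) unfolding totrec_def by blast
  have "computes X (PrimRec ef eg) (n # xs) (rec_nat (f xs) (\<lambda>n y. g (n # y # xs)) n)"
    if "length xs = k" for X n xs
    by (induction n) (auto intro!: computes.PrimRec_0 computes.PrimRec_Suc ef(2) eg(2) that)
  then have "computes X (PrimRec ef eg) zs
      (rec_nat (f (tl zs)) (\<lambda>n y. g (n # y # tl zs)) (hd zs))" if "length zs = Suc k" for X zs
    using that by (cases zs) auto
  then have "totrec (Suc k) (\<lambda>zs. rec_nat (f (tl zs)) (\<lambda>n y. g (n # y # tl zs)) (hd zs))"
    unfolding totrec_def using ef(1) eg(1) by (intro exI[of _ "PrimRec ef eg"]) simp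
  then have *: "totrec k (\<lambda>xs. (\<lambda>zs. rec_nat (f (tl zs)) (\<lambda>n y. g (n # y # tl zs)) (hd zs))
      (map (\<lambda>g. g xs) (h # map (\<lambda>i xs. xs ! i) [0..<k])))"
    by (intro totrec_Comp) (use assms(3) totrec_Proj in auto)
  have "map (\<lambda>i. xs ! i) [0..<k] = xs" if "length xs = k" for xs :: "nat list"
    using that map_nth by blast
  with * show ?thesis
    by (elim totrec_cong) (simp add: comp_def)
qed

section \<open>Arithmetic and case distinction\<close>

lemma totrec_add:
  assumes "totrec k f" and "totrec k g"
  shows "totrec k (\<lambda>xs. f xs + g xs)"
proof -
  have "rec_nat a (\<lambda>_ y. Suc y) b = a + b" for a b by (induction b) auto
  then show ?thesis
    using totrec_PrimRec[of k f "\<lambda>xs. Suc (xs ! 1)" g] assms by (simp add: totrec_Suc totrec_Proj)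
qed

lemma totrec_pred: assumes "totrec k f" shows "totrec k (\<lambda>xs. f xs - 1)"
proof -
  have "rec_nat 0 (\<lambda>n _. n) b = b - 1" for b by (induction b) auto
  then show ?thesis
    using totrec_PrimRec[of k "\<lambda>_. 0" "\<lambda>xs. xs ! 0" f] assms by (simp add: totrec_Zero totrec_Proj)
qed

lemma totrec_diff:
  assumes "totrec k f" and "totrec k g"
  shows "totrec k (\<lambda>xs. f xs - g xs)"
proof -
  have "rec_nat a (\<lambda>_ y. y - 1) b = a - b" for a b by (induction b) auto
  moreover have "totrec (Suc (Suc k)) (\<lambda>xs. xs ! 1 - 1)" by (intro totrec_pred totrec_Proj) simp
  ultimately show ?thesis using totrec_PrimRec[of k f "\<lambda>xs. xs ! 1 - 1" g] assms by simp
qed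

lemma totrec_mult:
  assumes "totrec k f" and "totrec k g"
  shows "totrec k (\<lambda>xs. f xs * g xs)"
proof -
  have *: "rec_nat 0 (\<lambda>_ y. y + a) b = a * b" for a b by (induction b) auto
  have "totrec 2 (\<lambda>xs. xs ! 0 * xs ! 1)"
    using totrec_PrimRec[of 2 "\<lambda>_. 0" "\<lambda>xs. xs ! 1 + xs ! 2" "\<lambda>xs. xs ! 1"]
    by (simp add: totrec_Zero totrec_Proj totrec_add numeral_2_eq_2 *[simplified numeral_2_eq_2])
  then show ?thesis using assms by (rule totrec_comp2)
qed

lemma totrec_power2: assumes "totrec k f" shows "totrec k (\<lambda>xs. 2 ^ f xs)"
proof -
  have "rec_nat 1 (\<lambda>_ y. 2 * y) b = (2 :: nat) ^ b" for b by (induction b) auto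
  moreover have "totrec (Suc (Suc k)) (\<lambda>xs. 2 * xs ! 1)"
    by (intro totrec_mult totrec_const totrec_Proj) simp
  ultimately show ?thesis
    using totrec_PrimRec[of k "\<lambda>_. 1" "\<lambda>xs. 2 * xs ! 1" f] assms by (simp add: totrec_const)
qed

lemma totrec_if_zero:
  assumes "totrec k p" and "totrec k f" and "totrec k g"
  shows "totrec k (\<lambda>xs. if p xs = 0 then f xs else g xs)"
proof -
  \<comment> \<open>Truncated subtraction makes \<open>1 - p xs\<close> the indicator of
    \<open>p xs = 0\<close>.\<close>
  have "totrec k (\<lambda>xs. (1 - p xs) * f xs + (1 - (1 - p xs)) * g xs)"
    by (intro totrec_add totrec_mult totrec_diff totrec_const assms)
  moreover have "(1 - p xs) * f xs + (1 - (1 - p xs)) * g xs = (if p xs = 0 then f xs else g xs)"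
    for xs by simp
  ultimately show ?thesis by simp
qed

lemma totrec_if_eq:
  assumes "totrec k p" and "totrec k q" and "totrec k f" and "totrec k g"
  shows "totrec k (\<lambda>xs. if p xs = q xs then f xs else g xs)"
proof -
  \<comment> \<open>The two truncated differences add up to the distance of the numbers, which
    vanishes exactly at equality.\<close>
  have "totrec k (\<lambda>xs. if (p xs - q xs) + (q xs - p xs) = 0 then f xs else g xs)"
    by (intro totrec_if_zero totrec_add totrec_diff assms)
  moreover have "(a - b) + (b - a) = 0 \<longleftrightarrow> a = b" for a b :: nat by auto
  ultimately show ?thesis by simp
qed

lemma totrec_mod:
  assumes "totrec k f" and "totrec k g"
  shows "totrec k (\<lambda>xs. f xs mod g xs)"
proof -
  \<comment> \<open>A counter (entry 1) is reset on reaching the modulus (entry 3). A modulus 0 is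
    never reached, in accordance with \<open>a mod 0 = a\<close>.\<close>
  let ?s = "\<lambda>xs. if Suc (xs ! 1) = xs ! 3 then 0 else Suc (xs ! 1)"
  have *: "rec_nat 0 (\<lambda>_ y. if Suc y = b then 0 else Suc y) a = a mod b" for a b
    by (induction a) (simp_all add: mod_Suc)
  have "totrec (Suc (Suc 2)) ?s" by (intro totrec_if_eq totrec_Suc totrec_Proj totrec_Zero) auto
  then have "totrec 2 (\<lambda>xs. rec_nat 0 (\<lambda>n y. ?s (n # y # xs)) (xs ! 0))"
    by (intro totrec_PrimRec totrec_Zero totrec_Proj) auto
  then have "totrec 2 (\<lambda>xs. xs ! 0 mod xs ! 1)"
    by (rule totrec_cong) (simp add: numeral_3_eq_3 * cong: if_cong)
  then show ?thesis using assms by (rule totrec_comp2)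
qed

lemma totrec_div:
  assumes "totrec k f" and "totrec k g"
  shows "totrec k (\<lambda>xs. f xs div g xs)"
proof -
  \<comment> \<open>The quotient grows at each multiple of the divisor; for divisor 0 it stays
    0.\<close>
  let ?s = "\<lambda>xs. if Suc (xs ! 0) mod xs ! 3 = 0 then Suc (xs ! 1) else xs ! 1"
  have *: "rec_nat 0 (\<lambda>n y. if Suc n mod b = 0 then Suc y else y) a = a div b" for a b
    by (induction a) (simp_all add: div_Suc)
  have "totrec (Suc (Suc 2)) ?s" by (intro totrec_if_zero totrec_mod totrec_Suc totrec_Proj) auto
  then have "totrec 2 (\<lambda>xs. rec_nat 0 (\<lambda>n y. ?s (n # y # xs)) (xs ! 0))"
    by (intro totrec_PrimRec totrec_Zero totrec_Proj) auto
  then have "totrec 2 (\<lambda>xs. xs ! 0 div xs ! 1)"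
    by (rule totrec_cong) (simp add: numeral_3_eq_3 * cong: if_cong)
  then show ?thesis using assms by (rule totrec_comp2)
qed

lemma totrec_rearrange:
  assumes "totrec (length is) f" and "\<forall>i \<in> set is. i < k"
  shows "totrec k (\<lambda>xs. f (map ((!) xs) is))"
proof -
  have "totrec k (\<lambda>xs. f (map (\<lambda>g. g xs) (map (\<lambda>i xs. xs ! i) is)))"
    by (rule totrec_Comp) (use assms in \<open>auto intro: totrec_Proj\<close>)
  then show ?thesis by (simp add: comp_def)
qed

lemma totrec_sum:
  assumes "totrec (Suc k) f" and "totrec k h"
  shows "totrec k (\<lambda>xs. \<Sum>i<h xs. f (i # xs))"
proof -
  \<comment> \<open>Entry 1 of the list is the accumulator; \<open>?is\<close> leaves it
    out.\<close>
  let ?is = "0 # map (\<lambda>i. Suc (Suc i)) [0..<k]"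
  let ?g = "\<lambda>zs. zs ! 1 + f (map ((!) zs) ?is)"
  have *: "rec_nat 0 (\<lambda>n y. y + f (n # xs)) b = (\<Sum>i<b. f (i # xs))" for b xs
    by (induction b) auto
  have g: "?g (n # y # xs) = y + f (n # xs)" if "length xs = k" for n y xs
    using map_nth[of xs] that by (simp add: comp_def)
  have "totrec (Suc (Suc k)) (\<lambda>zs. f (map ((!) zs) ?is))"
    by (rule totrec_rearrange) (use assms in auto)
  then have "totrec (Suc (Suc k)) ?g"
    by (intro totrec_add totrec_Proj) auto
  then have "totrec k (\<lambda>xs. rec_nat 0 (\<lambda>n y. ?g (n # y # xs)) (h xs))"
    by (intro totrec_PrimRec totrec_Zero assms(2))
  then show ?thesis
    by (rule totrec_cong) (simp only: g *)
qed

section \<open>Search and composition of partial functions\<close>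

text \<open>As \<open>f\<close> is total, the demand of \<open>Mu\<close> that all smaller values
  exist is automatic, so the search diverges only when there is no zero.\<close>

lemma partrec_Mu:
  assumes "totrec (Suc k) f"
  shows "partrec k (\<lambda>xs. if \<exists>n. f (n # xs) = 0 then Some (LEAST n. f (n # xs) = 0) else None)"
proof -
  obtain e where e: "query_free e" "\<And>X xs. length xs = Suc k \<Longrightarrow> computes X e xs (f xs)"
    using assms unfolding totrec_def by blast
  have val: "computes X e (n # xs) y \<longleftrightarrow> f (n # xs) = y" if "length xs = k" for X n xs y
    using e(2)[of "n # xs" X] that by (auto dest: computes_deterministic)
  have "computes X (Mu e) xs y \<longleftrightarrow>
      (if \<exists>n. f (n # xs) = 0 then Some (LEAST n. f (n # xs) = 0) else None) = Some y"
    if len: "length xs = k" for X xs y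
  proof
    assume "computes X (Mu e) xs y"
    then have "computes X e (y # xs) 0" and "\<forall>m<y. \<exists>z. computes X e (m # xs) (Suc z)"
      by (blast elim: computes_MuE)+
    then have y: "f (y # xs) = 0" and below: "\<forall>m<y. f (m # xs) \<noteq> 0"
      using val[OF len] by (metis, metis Zero_not_Suc)
    then have "(LEAST n. f (n # xs) = 0) = y"
      by (intro Least_equality) (auto simp flip: not_less)
    with y show "(if \<exists>n. f (n # xs) = 0 then Some (LEAST n. f (n # xs) = 0) else None) = Some y"
      by auto
  next
    assume "(if \<exists>n. f (n # xs) = 0 then Some (LEAST n. f (n # xs) = 0) else None) = Some y"
    then have ex: "\<exists>n. f (n # xs) = 0" and y: "y = (LEAST n. f (n # xs) = 0)"
      by (auto split: if_splits)
    have "f (y # xs) = 0" using ex unfolding y by (rule LeastI_ex)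
    moreover have "\<forall>m<y. \<exists>z. f (m # xs) = Suc z"
      unfolding y by (auto dest: not_less_Least intro: not0_implies_Suc)
    ultimately show "computes X (Mu e) xs y" by (intro computes.Mu) (simp_all add: val[OF len])
  qed
  then show ?thesis unfolding partrec_def using e(1) by (intro exI[of _ "Mu e"]) simp
qed

lemma totrec_Least:
  assumes "totrec (Suc k) f" and "\<And>xs. length xs = k \<Longrightarrow> \<exists>n. f (n # xs) = 0"
  shows "totrec k (\<lambda>xs. LEAST n. f (n # xs) = 0)"
proof -
  obtain e where "query_free e"
    and "\<And>X xs y. length xs = k \<Longrightarrow> computes X e xs y \<longleftrightarrow>
      (if \<exists>n. f (n # xs) = 0 then Some (LEAST n. f (n # xs) = 0) else None) = Some y"
    using partrec_Mu[OF assms(1)] unfolding partrec_def by blast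
  with assms(2) show ?thesis unfolding totrec_def by auto
qed

text \<open>\<open>Comp\<close> halts only when its arguments do, which is the strictness of
  \<open>Option.bind\<close>; projections pass \<open>xs\<close> on beside the new value.\<close>

lemma partrec_bind:
  assumes "partrec k g" and "partrec (Suc k) h"
  shows "partrec k (\<lambda>xs. Option.bind (g xs) (\<lambda>y. h (y # xs)))"
proof -
  obtain eg where eg: "query_free eg"
    "\<And>X xs y. length xs = k \<Longrightarrow> computes X eg xs y \<longleftrightarrow> g xs = Some y"
    using assms(1) unfolding partrec_def by blast
  obtain eh where eh: "query_free eh"
    "\<And>X xs y. length xs = Suc k \<Longrightarrow> computes X eh xs y \<longleftrightarrow> h xs = Some y"
    using assms(2) unfolding partrec_def by blast
  let ?e = "Comp eh (eg # map Proj [0..<k])"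
  have projs: "list_all2 (\<lambda>p y. computes X p xs y) (map Proj [0..<k]) ys \<longleftrightarrow> ys = xs"
    if "length xs = k" for X xs ys
  proof -
    have "computes X (Proj i) xs y \<longleftrightarrow> y = xs ! i" if "i < k" for i y
      using that \<open>length xs = k\<close> by (auto elim: computes_ProjE intro: computes.Proj)
    then show ?thesis
      using that by (auto simp: list_all2_conv_all_nth intro: nth_equalityI)
  qed
  have "computes X ?e xs y \<longleftrightarrow> Option.bind (g xs) (\<lambda>y. h (y # xs)) = Some y"
    if len: "length xs = k" for X xs y
  proof
    assume "computes X ?e xs y"
    then obtain zs where "list_all2 (\<lambda>p y. computes X p xs y) (eg # map Proj [0..<k]) zs"
      and "computes X eh zs y" by (rule computes_CompE)
    then show "Option.bind (g xs) (\<lambda>y. h (y # xs)) = Some y"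
      by (auto simp: list_all2_Cons1 projs[OF len] eg(2)[OF len] eh(2) len)
  next
    assume "Option.bind (g xs) (\<lambda>y. h (y # xs)) = Some y"
    then obtain z where "g xs = Some z" "h (z # xs) = Some y"
      by (auto simp: bind_eq_Some_conv)
    then show "computes X ?e xs y"
      by (intro computes.Comp[where ys = "z # xs"]) (simp_all add: projs[OF len] eg(2)[OF len] eh(2) len)
  qed
  then show ?thesis unfolding partrec_def using eg(1) eh(1) by (intro exI[of _ ?e]) auto
qed

lemma partrec_comp1:
  assumes "partrec 1 h" and "totrec k f"
  shows "partrec k (\<lambda>xs. h [f xs])"
proof -
  obtain eh where eh: "query_free eh"
    "\<And>X xs y. length xs = 1 \<Longrightarrow> computes X eh xs y \<longleftrightarrow> h xs = Some y"
    using assms(1) unfolding partrec_def by blast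
  obtain ef where ef: "query_free ef" "\<And>X xs. length xs = k \<Longrightarrow> computes X ef xs (f xs)"
    using assms(2) unfolding totrec_def by blast
  have "computes X (Comp eh [ef]) xs y \<longleftrightarrow> h [f xs] = Some y" if len: "length xs = k" for X xs y
  proof
    assume "computes X (Comp eh [ef]) xs y"
    then obtain zs where "list_all2 (\<lambda>p y. computes X p xs y) [ef] zs" and zs: "computes X eh zs y"
      by (rule computes_CompE)
    then obtain z where "zs = [z]" "computes X ef xs z" by (auto simp: list_all2_Cons1)
    moreover have "computes X ef xs (f xs)" using len by (rule ef(2))
    ultimately have "zs = [f xs]" using computes_deterministic by blast
    with zs eh(2) show "h [f xs] = Some y" by simp
  next
    assume "h [f xs] = Some y"
    then have "computes X eh [f xs] y" by (simp add: eh(2))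
    then show "computes X (Comp eh [ef]) xs y"
      by (intro computes.Comp[where ys = "[f xs]"]) (simp_all add: ef(2) len)
  qed
  then show ?thesis
    unfolding partrec_def using eh(1) ef(1) by (intro exI[of _ "Comp eh [ef]"]) simp
qed

section \<open>Binary representation of strings and the 2-adic valuation\<close>

text \<open>
  \<open>bcode \<sigma>\<close> is the number with binary digits \<open>\<sigma>\<close>, least significant first, and a leading digit
  one on top. Dropping bits of \<open>\<sigma>\<close> is thus division by a power of two, with result 0 exactly
  when \<open>\<sigma>\<close> is too short.
\<close>

definition bcode :: "bool list \<Rightarrow> nat" where
  "bcode \<sigma> = Suc (str_code \<sigma>)"

lemma bcode_Nil [simp]: "bcode [] = 1"
  by (simp add: bcode_def)

lemma bcode_Cons [simp]: "bcode (b # \<sigma>) = 2 * bcode \<sigma> + of_bool b"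
  by (simp add: bcode_def)

lemma bcode_inject: "bcode \<sigma> = bcode \<tau> \<longleftrightarrow> \<sigma> = \<tau>"
  using bij_str_code by (simp add: bcode_def bij_def inj_eq)

lemma bcode_snoc: "bcode (\<sigma> @ [b]) = bcode \<sigma> + 2 ^ length \<sigma> + of_bool b * 2 ^ length \<sigma>"
  by (induction \<sigma>) (auto simp: algebra_simps)

lemma bcode_map_upt: "bcode (map P [0..<m]) = 2 ^ m + (\<Sum>i<m. of_bool (P i) * 2 ^ i)"
  by (induction m) (simp_all add: bcode_snoc)

lemma bcode_div_power2:
  "bcode \<sigma> div 2 ^ k = (if k \<le> length \<sigma> then bcode (drop k \<sigma>) else 0)"
proof (induction k arbitrary: \<sigma>)
  case (Suc k)
  have "(1 :: nat) div 2 ^ Suc k = 0"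
    by (intro div_less one_less_power) auto
  show ?case
  proof (cases \<sigma>)
    case Nil
    with \<open>1 div 2 ^ Suc k = 0\<close> show ?thesis by simp
  next
    case (Cons b s)
    have "bcode \<sigma> div 2 ^ Suc k = bcode s div 2 ^ k"
      by (simp add: Cons div_mult2_eq)
    with Cons show ?thesis by (simp add: Suc.IH)
  qed
qed simp

lemma odd_bcode_div: "j < length \<sigma> \<Longrightarrow> odd (bcode \<sigma> div 2 ^ j) \<longleftrightarrow> \<sigma> ! j"
  by (simp add: bcode_div_power2 flip: Cons_nth_drop_Suc)

text \<open>The \<open>k\<close> lowest binary digits of \<open>r\<close> form \<open>b\<close>, and
  whatever follows changes only higher digits. So a residue can be read off without cutting
  \<open>b\<close> out of the input.\<close>

lemma ex_bcode_append_mod: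
  "\<exists>b. length b = k \<and> (\<forall>\<sigma>. bcode (b @ \<sigma>) mod 2 ^ k = r mod 2 ^ k)"
proof (induction k arbitrary: r)
  case (Suc k)
  obtain b where b: "length b = k" "\<And>\<sigma>. bcode (b @ \<sigma>) mod 2 ^ k = (r div 2) mod 2 ^ k"
    using Suc.IH by blast
  have step: "(2 * x + of_bool (odd r)) mod 2 ^ Suc k = r mod 2 ^ Suc k"
    if "x mod 2 ^ k = (r div 2) mod 2 ^ k" for x
  proof -
    have "(2 * x + of_bool (odd r)) mod 2 ^ Suc k = 2 * (x mod 2 ^ k) + of_bool (odd r)"
      by (simp add: mod_mult2_eq)
    also have "\<dots> = r mod 2 ^ Suc k"
      using mod_mult2_eq[of r 2 "2 ^ k"] by (simp add: that mod_2_eq_odd)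
    finally show ?thesis .
  qed
  show ?case
    by (rule exI[of _ "odd r # b"]) (use b step in auto)
qed simp

text \<open>The exponent of 2 in \<open>n\<close>, phrased as a search. At 0 the predicate is empty,
  hence the arguments below are successors or values of \<open>bcode\<close>.\<close>

definition val2 :: "nat \<Rightarrow> nat" where
  "val2 n = (LEAST v. n mod 2 ^ Suc v \<noteq> 0)"

lemma val2_eq: "val2 (2 ^ v * (2 * t + 1)) = v"
  unfolding val2_def
proof (rule Least_equality)
  have "(2 ^ v * (2 * t + 1)) mod 2 ^ Suc v = 2 ^ v * ((2 * t + 1) mod 2)"
    by (metis mult_mod_right power_Suc2)
  then show "(2 ^ v * (2 * t + 1)) mod 2 ^ Suc v \<noteq> 0" by simp
next
  fix w assume w: "2 ^ v * (2 * t + 1) mod 2 ^ Suc w \<noteq> 0"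
  show "v \<le> w"
  proof (rule ccontr)
    assume "\<not> v \<le> w"
    then have "2 ^ Suc w dvd (2 :: nat) ^ v" by (intro le_imp_power_dvd) simp
    then have "2 ^ Suc w dvd 2 ^ v * (2 * t + 1)" by (rule dvd_mult2)
    with w show False by (metis dvd_imp_mod_0)
  qed
qed

text \<open>Each leading \<open>False\<close> is a factor 2. The remaining factor is odd because of
  the first \<open>True\<close>, or of the leading digit one if there is none.\<close>

lemma ex_bcode_odd_part: "\<exists>t. bcode \<sigma> = 2 ^ length (takeWhile Not \<sigma>) * (2 * t + 1)"
proof (induction \<sigma>)
  case Nil
  show ?case by (intro exI[of _ 0]) simp
next
  case (Cons b \<sigma>)
  then show ?case by (cases b) (auto intro: exI[of _ "bcode \<sigma>"])
qed

text \<open>This lets arithmetic read the unary header of an input.\<close>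

lemma val2_bcode: "val2 (bcode \<sigma>) = length (takeWhile Not \<sigma>)"
  using ex_bcode_odd_part[of \<sigma>] val2_eq by metis

lemma totrec_val2:
  assumes "totrec k f"
  shows "totrec k (\<lambda>xs. val2 (Suc (f xs)))"
proof -
  \<comment> \<open>\<open>1 - x\<close> is zero exactly for nonzero \<open>x\<close>, so a zero of
    \<open>?g\<close> satisfies the predicate in \<open>val2\<close>.\<close>
  let ?g = "\<lambda>zs. 1 - Suc (zs ! 1) mod 2 ^ Suc (zs ! 0)"
  have "totrec (Suc 1) ?g"
    by (intro totrec_diff totrec_mod totrec_power2 totrec_Suc totrec_const totrec_Proj) auto
  moreover have "\<exists>n. ?g (n # xs) = 0" if "length xs = 1" for xs
  proof -
    have "Suc (xs ! 0) < 2 ^ Suc (Suc (xs ! 0))"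
      by (metis lessI less_exp less_trans)
    then show ?thesis by (intro exI[of _ "Suc (xs ! 0)"]) simp
  qed
  ultimately have "totrec 1 (\<lambda>xs. LEAST n. ?g (n # xs) = 0)" by (rule totrec_Least)
  then have "totrec 1 (\<lambda>xs. val2 (Suc (xs ! 0)))"
    by (rule totrec_cong) (simp add: val2_def Suc_le_eq)
  then show ?thesis using assms by (rule totrec_comp1)
qed

section \<open>Prefix-free machines\<close>

lemma partial_recursive_on_strings_iff_partrec:
  "partial_recursive_on_strings M \<longleftrightarrow>
     partrec 1 (\<lambda>xs. map_option str_code (M (inv str_code (xs ! 0))))"
proof -
  have str: "inv str_code (str_code \<sigma>) = \<sigma>" "str_code (inv str_code n) = n" for \<sigma> n
    using bij_str_code by (simp_all add: bij_def surj_f_inv_f)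
  have "(\<forall>X \<sigma> \<tau>. M \<sigma> = Some \<tau> \<longleftrightarrow> computes X e [str_code \<sigma>] (str_code \<tau>)) \<longleftrightarrow>
    (\<forall>X xs y. length xs = 1 \<longrightarrow>
      (computes X e xs y \<longleftrightarrow> map_option str_code (M (inv str_code (xs ! 0))) = Some y))"
    (is "?L \<longleftrightarrow> ?R") for e
  proof
    assume L: ?L
    show ?R
    proof (intro allI impI)
      fix X and xs :: "nat list" and y assume "length xs = 1"
      then obtain c where c: "xs = [c]" by (auto simp: length_Suc_conv)
      have "computes X e [c] y \<longleftrightarrow> M (inv str_code c) = Some (inv str_code y)"
        using L[rule_format, of "inv str_code c" "inv str_code y" X] by (simp add: str)
      then show "computes X e xs y \<longleftrightarrow> map_option str_code (M (inv str_code (xs ! 0))) = Some y"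
        by (auto simp: c str)
    qed
  next
    assume R: ?R
    show ?L
    proof (intro allI)
      fix X \<sigma> \<tau>
      show "M \<sigma> = Some \<tau> \<longleftrightarrow> computes X e [str_code \<sigma>] (str_code \<tau>)"
        using R[rule_format, of "[str_code \<sigma>]" X "str_code \<tau>"] bij_str_code
        by (auto simp: str bij_def inj_eq)
    qed
  qed
  then show ?thesis
    unfolding partial_recursive_on_strings_def partrec_def by simp
qed

lemma partial_recursive_on_strings_if_partrec:
  assumes "partrec 1 f" and "\<And>\<sigma>. f [str_code \<sigma>] = map_option str_code (M \<sigma>)"
  shows "partial_recursive_on_strings M"
proof -
  have *: "map_option str_code (M (inv str_code (xs ! 0))) = f xs" if "length xs = 1" for xs
  proof -
    obtain c where "xs = [c]" using \<open>length xs = 1\<close> by (cases xs) auto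
    then show ?thesis
      using assms(2)[of "inv str_code c"] bij_str_code by (simp add: bij_def surj_f_inv_f)
  qed
  show ?thesis
    using assms(1) unfolding partial_recursive_on_strings_iff_partrec partrec_def
    by (simp add: * cong: conj_cong imp_cong)
qed

text \<open>These are the strings of \<open>k\<close> zeros and a final one: that one and the
  leading digit give \<open>2 ^ k + 2 ^ (k + 1)\<close>. The first one in a string fixes
  \<open>k\<close>.\<close>

lemma prefix_free_bcode: "prefix_free {\<sigma>. \<exists>k. bcode \<sigma> = 3 * 2 ^ k}"
proof -
  have eq: "\<sigma> = replicate k False @ [True]" if "bcode \<sigma> = 3 * 2 ^ k" for \<sigma> k
  proof -
    have "bcode (replicate k False @ [True]) = 3 * 2 ^ k" by (induction k) auto
    with that show ?thesis using bcode_inject by metis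
  qed
  have "\<sigma> = \<tau>" if \<sigma>: "bcode \<sigma> = 3 * 2 ^ k" and \<tau>: "bcode \<tau> = 3 * 2 ^ l" and "prefix \<sigma> \<tau>"
    for \<sigma> \<tau> k l
  proof -
    from \<open>prefix \<sigma> \<tau>\<close> have "takeWhile Not \<tau> = takeWhile Not \<sigma>"
      by (auto simp: eq[OF \<sigma>] prefix_def takeWhile_append)
    then have "replicate l False = replicate k False"
      by (simp add: eq[OF \<sigma>] eq[OF \<tau>] takeWhile_append)
    then show ?thesis by (simp add: eq[OF \<sigma>] eq[OF \<tau>])
  qed
  then show ?thesis unfolding prefix_free_def by blast
qed

text \<open>
  Without this, \<open>K U \<sigma>\<close> could be the junk value of \<open>LEAST\<close> on an empty predicate. The machine
  sends the string of \<open>k\<close> zeros followed by a one to the string with code \<open>k\<close>.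
\<close>

lemma universal_imp_surj:
  assumes "universal U"
  shows "\<exists>\<pi>. U \<pi> = Some \<tau>"
proof -
  \<comment> \<open>The distance between \<open>bcode\<close> of the input and
    \<open>3 * 2 ^ k\<close>, whose zero \<open>k\<close> is searched for.\<close>
  let ?f = "\<lambda>zs. (Suc (zs ! 1) - 3 * 2 ^ (zs ! 0)) + (3 * 2 ^ (zs ! 0) - Suc (zs ! 1))"
  define M where "M \<sigma> = (if \<exists>k. bcode \<sigma> = 3 * 2 ^ k
    then Some (inv str_code (LEAST k. bcode \<sigma> = 3 * 2 ^ k)) else None)" for \<sigma>
  have f: "?f [k, str_code \<sigma>] = 0 \<longleftrightarrow> bcode \<sigma> = 3 * 2 ^ k" for k \<sigma>
    by (auto simp: bcode_def)
  have "totrec (Suc 1) ?f"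
    by (intro totrec_add totrec_diff totrec_mult totrec_power2 totrec_Suc totrec_const totrec_Proj) auto
  then have "partrec 1 (\<lambda>xs. if \<exists>n. ?f (n # xs) = 0
      then Some (LEAST n. ?f (n # xs) = 0) else None)"
    by (rule partrec_Mu)
  then have "partial_recursive_on_strings M"
  proof (rule partial_recursive_on_strings_if_partrec)
    show "(if \<exists>n. ?f (n # [str_code \<sigma>]) = 0
        then Some (LEAST n. ?f (n # [str_code \<sigma>]) = 0) else None) = map_option str_code (M \<sigma>)" for \<sigma>
      using bij_str_code unfolding f M_def by (simp add: bij_def surj_f_inv_f)
  qed
  moreover have "dom M = {\<sigma>. \<exists>k. bcode \<sigma> = 3 * 2 ^ k}" by (auto simp: M_def split: if_splits)
  ultimately have "prefix_free_machine M"
    by (simp add: prefix_free_machine_def prefix_free_bcode)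
  then obtain \<rho> where \<rho>: "\<And>\<sigma>. U (\<rho> @ \<sigma>) = M \<sigma>" using assms unfolding universal_def by blast
  let ?\<sigma> = "inv str_code (3 * 2 ^ str_code \<tau> - 1)"
  have "bcode ?\<sigma> = 3 * 2 ^ str_code \<tau>"
    using bij_str_code by (simp add: bcode_def bij_def surj_f_inv_f)
  moreover from this have "(LEAST k. bcode ?\<sigma> = 3 * 2 ^ k) = str_code \<tau>"
    by (intro Least_equality) auto
  ultimately have "M ?\<sigma> = Some \<tau>" using bij_str_code by (auto simp: M_def bij_def)
  with \<rho> show ?thesis by metis
qed

lemma K_le: "U \<pi> = Some \<sigma> \<Longrightarrow> K U \<sigma> \<le> length \<pi>"
  unfolding K_def by (intro Least_le) auto

lemma K_attained:
  assumes "universal U"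
  obtains \<pi> where "U \<pi> = Some \<sigma>" and "length \<pi> = K U \<sigma>"
proof -
  have "\<exists>n \<pi>. length \<pi> = n \<and> U \<pi> = Some \<sigma>" using universal_imp_surj[OF assms] by blast
  then have "\<exists>\<pi>. length \<pi> = K U \<sigma> \<and> U \<pi> = Some \<sigma>" unfolding K_def by (rule LeastI_ex)
  then show thesis using that by blast
qed

section \<open>Spreading a sequence over all windows\<close>

text \<open>Positions \<open>p\<close> with \<open>val2 (Suc p) = v\<close> lie
  \<open>2 ^ (v + 1)\<close> apart, and \<open>t\<close> has to run through
  \<open>2 ^ (q * v)\<close> residues; \<open>2 ^ wexp q v\<close> is the product.\<close>

definition wexp :: "nat \<Rightarrow> nat \<Rightarrow> nat" where
  "wexp q v = (q + 1) * v + 1"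

text \<open>The division strips the lowest one bit and the zeros below it, leaving \<open>t\<close>;
  the successor keeps the valuation away from 0.\<close>

definition spread :: "nat \<Rightarrow> nat \<Rightarrow> nat" where
  "spread q p = Suc p div 2 ^ Suc (val2 (Suc p)) mod 2 ^ (q * val2 (Suc p))"

text \<open>
  \<open>w\<close> has to be congruent to \<open>- (s + 1)\<close> modulo \<open>2 ^ wexp q v\<close> when the window \<open>\<tau>\<close> starts at \<open>s\<close>;
  \<open>bcode\<close> makes the definition arithmetical also for a \<open>\<tau>\<close> that is too short.
\<close>

definition gather :: "nat \<Rightarrow> nat \<Rightarrow> nat \<Rightarrow> bool list \<Rightarrow> bool list" where
  "gather q v w \<tau> = map (\<lambda>i. odd (bcode \<tau> div 2 ^ ((2 ^ v * (2 * i + 1) + w) mod 2 ^ wexp q v)))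
     [0..<2 ^ (q * v)]"

lemma spread_eq:
  assumes "Suc p = 2 ^ v * (2 * t + 1)"
  shows "spread q p = t mod 2 ^ (q * v)"
proof -
  have "val2 (Suc p) = v" unfolding assms by (rule val2_eq)
  moreover have "2 ^ v * (2 * t + 1) div 2 ^ Suc v = t"
    by (simp add: div_mult2_eq mult.commute[of 2])
  ultimately show ?thesis by (simp add: spread_def assms)
qed

lemma power2_wexp: "(2 :: nat) ^ wexp q v = 2 ^ v * (2 * 2 ^ (q * v))"
  by (simp add: wexp_def power_add algebra_simps)

text \<open>As \<open>w + Suc s\<close> is divisible by the period, adding \<open>w\<close> turns
  the residue of an absolute position into an offset in the window, and a window as long as the
  period contains every such offset.\<close>

lemma gather_window:
  assumes n: "2 ^ wexp q v \<le> n" and w: "(w + Suc s) mod 2 ^ wexp q v = 0"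
  shows "gather q v w (map (\<lambda>p. X (spread q p)) [s..<s + n]) = restr X (2 ^ (q * v))"
proof -
  let ?W = "2 ^ wexp q v :: nat" and ?m = "2 ^ (q * v) :: nat"
  have "odd (bcode (map (\<lambda>p. X (spread q p)) [s..<s + n]) div 2 ^ ((2 ^ v * (2 * i + 1) + w) mod ?W))
      = X i" if i: "i < ?m" for i
  proof -
    define j where "j = (2 ^ v * (2 * i + 1) + w) mod ?W"
    define k where "k = Suc (s + j) div ?W"
    have "j < ?W" by (simp add: j_def)
    have "2 ^ v * (2 * i + 1) < 2 ^ v * (2 * ?m)" using i by (intro mult_strict_left_mono) auto
    then have small: "2 ^ v * (2 * i + 1) < ?W" by (simp add: power2_wexp)
    have "Suc (s + j) mod ?W = (Suc s + (2 ^ v * (2 * i + 1) + w)) mod ?W"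
      unfolding j_def by (simp only: mod_add_right_eq flip: add_Suc)
    also have "\<dots> = ((w + Suc s) + 2 ^ v * (2 * i + 1)) mod ?W" by (simp only: ac_simps)
    also have "\<dots> = 2 ^ v * (2 * i + 1) mod ?W"
      using w by (metis add_0 mod_add_left_eq)
    also have "\<dots> = 2 ^ v * (2 * i + 1)" using small by simp
    finally have "Suc (s + j) = 2 ^ v * (2 * i + 1) + ?W * k"
      unfolding k_def using mod_mult_div_eq[of "Suc (s + j)" ?W] by argo
    \<comment> \<open>The period is \<open>2 ^ v * (2 * ?m)\<close>: moving by \<open>k\<close>
      periods changes \<open>t\<close> by \<open>?m * k\<close>, which \<open>spread\<close> reduces
      away.\<close>
    also have "\<dots> = 2 ^ v * (2 * (i + ?m * k) + 1)"
      by (simp add: power2_wexp algebra_simps)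
    finally have "spread q (s + j) = (i + ?m * k) mod ?m" by (rule spread_eq)
    then have "spread q (s + j) = i" using i by simp
    with \<open>j < ?W\<close> n show ?thesis
      unfolding j_def[symmetric] by (simp add: odd_bcode_div)
  qed
  then show ?thesis unfolding gather_def restr_def by (intro map_cong) auto
qed

lemma totrec_wexp: "totrec k f \<Longrightarrow> totrec k (\<lambda>xs. wexp q (f xs))"
  unfolding wexp_def by (intro totrec_add totrec_mult totrec_const)

lemma totrec_spread: "totrec 1 (\<lambda>xs. spread q (xs ! 0))"
  unfolding spread_def
  by (intro totrec_mod totrec_div totrec_power2 totrec_mult totrec_Suc totrec_val2 totrec_const
      totrec_Proj) auto

section \<open>Describing prefixes by windows\<close>

text \<open>
  The input consists of \<open>v\<close> in unary, \<open>wexp q v\<close> bits that determine the position of the window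
  modulo \<open>2 ^ wexp q v\<close>, and a \<open>U\<close>-program for the window.
\<close>

definition window_machine ::
    "nat \<Rightarrow> (bool list \<Rightarrow> bool list option) \<Rightarrow> bool list \<Rightarrow> bool list option" where
  "window_machine q U \<sigma> =
     (let v = length (takeWhile Not \<sigma>); k = Suc v + wexp q v
      in if k \<le> length \<sigma> then map_option (gather q v (bcode (drop (Suc v) \<sigma>))) (U (drop k \<sigma>))
         else None)"

lemma window_machine_eq:
  assumes "length b = wexp q v"
  shows "window_machine q U (replicate v False @ True # b @ \<pi>) =
    map_option (gather q v (bcode (b @ \<pi>))) (U \<pi>)"
  using assms by (simp add: window_machine_def takeWhile_append)

text \<open>A domain element contains its full unary header, so an extension has the same
  \<open>v\<close> and cut \<open>k\<close>; the remainders are then comparable elements of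
  \<open>dom U\<close>.\<close>

lemma prefix_free_window_machine:
  assumes "prefix_free (dom U)"
  shows "prefix_free (dom (window_machine q U))"
  unfolding prefix_free_def
proof (intro ballI impI)
  fix \<sigma> \<tau> assume \<sigma>: "\<sigma> \<in> dom (window_machine q U)" and \<tau>: "\<tau> \<in> dom (window_machine q U)"
    and "prefix \<sigma> \<tau>"
  then obtain \<zeta> where \<zeta>: "\<tau> = \<sigma> @ \<zeta>" by (auto simp: prefix_def)
  define v where "v = length (takeWhile Not \<sigma>)"
  define k where "k = Suc v + wexp q v"
  have k: "k \<le> length \<sigma>" "drop k \<sigma> \<in> dom U"
    using \<sigma> by (auto simp: window_machine_def Let_def v_def k_def split: if_splits)
  \<comment> \<open>The bound on \<open>k\<close> puts the \<open>True\<close> that ends the header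
    inside \<open>\<sigma>\<close>, so extending cannot lengthen the run of zeros.\<close>
  then have "length (takeWhile Not \<sigma>) < length \<sigma>" by (simp add: k_def v_def)
  then have "takeWhile Not \<sigma> \<noteq> \<sigma>" by (metis less_irrefl)
  then have "\<exists>x \<in> set \<sigma>. x" by (auto simp: takeWhile_eq_all_conv)
  then have "takeWhile Not \<tau> = takeWhile Not \<sigma>" by (auto simp: \<zeta> takeWhile_append)
  then have "drop k \<tau> \<in> dom U"
    using \<tau> by (auto simp: window_machine_def Let_def v_def k_def split: if_splits)
  moreover have "drop k \<tau> = drop k \<sigma> @ \<zeta>" using k(1) by (simp add: \<zeta>)
  ultimately have "drop k \<sigma> = drop k \<sigma> @ \<zeta>"
    using assms k(2) unfolding prefix_free_def by (metis prefixI)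
  then show "\<sigma> = \<tau>" by (simp add: \<zeta>)
qed

text \<open>On codes all steps are arithmetic: search for the code of the \<open>U\<close>-program,
  run \<open>U\<close>, assemble the output.\<close>

lemma partial_recursive_window_machine:
  assumes "partial_recursive_on_strings U"
  shows "partial_recursive_on_strings (window_machine q U)"
proof -
  let ?hU = "\<lambda>xs. map_option str_code (U (inv str_code (xs ! 0)))"
  let ?k = "\<lambda>c. Suc (val2 (Suc c)) + wexp q (val2 (Suc c))"
  \<comment> \<open>The distance between \<open>Suc p\<close> and
    \<open>bcode \<sigma> div 2 ^ k\<close>. For too short an input the quotient is 0, not a
    successor, so the search diverges as required.\<close>
  let ?\<phi> = "\<lambda>zs. (Suc (zs ! 0) - Suc (zs ! 1) div 2 ^ ?k (zs ! 1)) +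
    (Suc (zs ! 1) div 2 ^ ?k (zs ! 1) - Suc (zs ! 0))"
  \<comment> \<open>The arguments are \<open>i\<close> and the codes of window,
    \<open>U\<close>-program and input; the value is bit \<open>i\<close> of the output with weight
    \<open>2 ^ i\<close>.\<close>
  let ?bit = "\<lambda>zs. let v = val2 (Suc (zs ! 3)) in Suc (zs ! 1) div 2 ^
    ((2 ^ v * (2 * zs ! 0 + 1) + Suc (zs ! 3) div 2 ^ Suc v) mod 2 ^ wexp q v) mod 2 * 2 ^ (zs ! 0)"
  let ?m = "\<lambda>zs. 2 ^ (q * val2 (Suc (zs ! 2)))"
  \<comment> \<open>Leading digit plus weighted bits is \<open>bcode\<close> of the output;
    subtracting 1 gives \<open>str_code\<close>.\<close>
  let ?D = "\<lambda>zs. 2 ^ ?m zs + (\<Sum>i<?m zs. ?bit (i # zs)) - 1"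
  let ?f = "\<lambda>xs. Option.bind
      (if \<exists>n. ?\<phi> (n # xs) = 0 then Some (LEAST n. ?\<phi> (n # xs) = 0) else None)
      (\<lambda>p. (\<lambda>ys. Option.bind (?hU [ys ! 0]) (\<lambda>t. Some (?D (t # ys)))) (p # xs))"
  have "totrec (Suc 1) ?\<phi>"
    by (intro totrec_add totrec_diff totrec_div totrec_power2 totrec_Suc totrec_val2 totrec_wexp
        totrec_Proj) auto
  then have \<phi>: "partrec 1 (\<lambda>xs. if \<exists>n. ?\<phi> (n # xs) = 0 then Some (LEAST n. ?\<phi> (n # xs) = 0) else None)"
    by (rule partrec_Mu)
  have "totrec (Suc (Suc (Suc 1))) ?bit"
    unfolding Let_def
    by (intro totrec_mult totrec_mod totrec_add totrec_div totrec_power2 totrec_Suc totrec_val2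
        totrec_wexp totrec_Proj totrec_const) auto
  then have "totrec (Suc (Suc 1)) ?D"
    by (intro totrec_diff totrec_add totrec_sum totrec_power2 totrec_mult totrec_val2 totrec_Suc
        totrec_const totrec_Proj) auto
  then have D: "partrec (Suc (Suc 1)) (\<lambda>zs. Some (?D zs))" by (rule partrec_if_totrec)
  have "partrec (Suc 1) (\<lambda>ys. ?hU [ys ! 0])"
    using assms unfolding partial_recursive_on_strings_iff_partrec
    by (rule partrec_comp1) (auto intro: totrec_Proj)
  with \<phi> D have "partrec 1 ?f" by (intro partrec_bind)
  then show ?thesis
  proof (rule partial_recursive_on_strings_if_partrec)
    fix \<sigma>
    define v where "v = length (takeWhile Not \<sigma>)"
    have v: "val2 (Suc (str_code \<sigma>)) = v"
      using val2_bcode[of \<sigma>] by (simp add: bcode_def v_def)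
    define k where "k = Suc v + wexp q v"
    have \<phi>: "?\<phi> [n, str_code \<sigma>] = 0 \<longleftrightarrow> k \<le> length \<sigma> \<and> n = str_code (drop k \<sigma>)" for n
    proof -
      have "?\<phi> [n, str_code \<sigma>] = 0 \<longleftrightarrow> Suc n = bcode \<sigma> div 2 ^ k"
        by (auto simp: v bcode_def k_def)
      then show ?thesis by (simp add: bcode_div_power2) (simp add: bcode_def)
    qed
    have D: "?D [str_code \<tau>, p, str_code \<sigma>] = str_code (gather q v (bcode (drop (Suc v) \<sigma>)) \<tau>)"
      if "k \<le> length \<sigma>" for \<tau> p
    proof -
      have "bcode (drop (Suc v) \<sigma>) = bcode \<sigma> div 2 ^ Suc v"
        using that by (simp only: bcode_div_power2) (simp add: k_def)
      then have "?D [str_code \<tau>, p, str_code \<sigma>]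
          = bcode (gather q v (bcode (drop (Suc v) \<sigma>)) \<tau>) - 1"
        unfolding gather_def bcode_map_upt
        by (simp add: Let_def val2_bcode mod_2_eq_odd flip: bcode_def v_def)
      then show ?thesis by (simp add: bcode_def)
    qed
    have wm: "window_machine q U \<sigma> = (if k \<le> length \<sigma>
        then map_option (gather q v (bcode (drop (Suc v) \<sigma>))) (U (drop k \<sigma>)) else None)"
      by (simp add: window_machine_def Let_def v_def k_def)
    have least: "(LEAST n. n = a) = a" for a :: nat by (rule Least_equality) auto
    have inv: "inv str_code (str_code \<tau>) = \<tau>" for \<tau> using bij_str_code by (simp add: bij_def)
    show "?f [str_code \<sigma>] = map_option str_code (window_machine q U \<sigma>)"
    proof (cases "k \<le> length \<sigma>")
      case True
      then have "?f [str_code \<sigma>] = Option.bind (map_option str_code (U (drop k \<sigma>)))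
          (\<lambda>t. Some (?D [t, str_code (drop k \<sigma>), str_code \<sigma>]))"
        unfolding \<phi> by (simp add: inv least)
      also have "\<dots> = map_option str_code (window_machine q U \<sigma>)"
        by (cases "U (drop k \<sigma>)")
          (simp_all only: option.map Option.bind.simps D[OF True] wm True if_True)
      finally show ?thesis .
    next
      case False
      then show ?thesis unfolding \<phi> wm by simp
    qed
  qed
qed

text \<open>The description consists of the fixed prefix \<open>\<rho>\<close>, the header, the
  position and a shortest program for the window; \<open>c\<close> is chosen before
  \<open>X\<close>, \<open>s\<close>, \<open>n\<close> and \<open>v\<close>.\<close>

lemma K_prefix_le_K_window:
  assumes "universal U"
  obtains c where "\<And>X s n v. 2 ^ wexp q v \<le> n \<Longrightarrow> K U (restr X (2 ^ (q * v)))
    \<le> K U (map (\<lambda>p. X (spread q p)) [s..<s + n]) + Suc v + wexp q v + c"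
proof -
  have "prefix_free_machine (window_machine q U)"
    using assms unfolding universal_def prefix_free_machine_def
    by (blast intro: prefix_free_window_machine partial_recursive_window_machine)
  then obtain \<rho> where \<rho>: "\<And>\<sigma>. U (\<rho> @ \<sigma>) = window_machine q U \<sigma>"
    using assms unfolding universal_def by blast
  have "K U (restr X (2 ^ (q * v)))
      \<le> K U (map (\<lambda>p. X (spread q p)) [s..<s + n]) + Suc v + wexp q v + length \<rho>"
    if n: "2 ^ wexp q v \<le> n" for X s n v
  proof -
    let ?\<tau> = "map (\<lambda>p. X (spread q p)) [s..<s + n]"
    let ?W = "2 ^ wexp q v :: nat"
    obtain \<pi> where \<pi>: "U \<pi> = Some ?\<tau>" "length \<pi> = K U ?\<tau>" using K_attained[OF assms] .
    \<comment> \<open>\<open>(?W - 1) * Suc s\<close> stands for \<open>- Suc s\<close> modulo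
      \<open>?W\<close>, the residue that \<open>gather_window\<close> asks for.\<close>
    obtain b where b: "length b = wexp q v"
      "bcode (b @ \<pi>) mod ?W = (?W - 1) * Suc s mod ?W"
      using ex_bcode_append_mod by blast
    have "(bcode (b @ \<pi>) + Suc s) mod ?W = ((?W - 1) * Suc s + Suc s) mod ?W"
      using b(2) by (metis mod_add_left_eq)
    also have "(?W - 1) * Suc s + Suc s = ?W * Suc s"
      by (metis Suc_pred' add.commute mult_Suc zero_less_numeral zero_less_power)
    finally have w: "(bcode (b @ \<pi>) + Suc s) mod ?W = 0" by simp
    have "U (\<rho> @ replicate v False @ True # b @ \<pi>) = Some (restr X (2 ^ (q * v)))"
      unfolding \<rho> window_machine_eq[OF b(1)] by (simp add: \<pi>(1) gather_window[OF n w])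
    then have "K U (restr X (2 ^ (q * v))) \<le> length (\<rho> @ replicate v False @ True # b @ \<pi>)"
      by (rule K_le)
    then show ?thesis by (simp add: b(1) \<pi>(2))
  qed
  then show thesis by (rule that)
qed

section \<open>Growth estimate and shift-complexity\<close>

text \<open>After division by \<open>2 powr (b * v)\<close> the left side tends to 0, so it is
  eventually below 1; \<open>C\<close> absorbs the finitely many earlier values.\<close>

lemma exponential_dominates:
  fixes a b A B D :: real
  assumes "0 < a" and "a < b"
  obtains C where "C \<ge> 0"
    and "\<And>v::nat. A * 2 powr (a * v) + B * v + D \<le> 2 powr (b * v) + C"
proof -
  define f where "f v = A * 2 powr (a * real v) + B * real v + D" for v :: nat
  define x y :: real where "x = 2 powr (- b)" and "y = 2 powr (a - b)"
  have x: "norm x < 1" and y: "norm y < 1"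
    using assms by (auto simp: x_def y_def powr_less_one)
  have "(\<lambda>v. A * y ^ v + B * (real v * x ^ v) + D * x ^ v) \<longlonglongrightarrow> A * 0 + B * 0 + D * 0"
    using x y by (intro tendsto_intros powser_times_n_limit_0 LIMSEQ_power_zero)
  then have "\<forall>\<^sub>F v in sequentially. A * y ^ v + B * (real v * x ^ v) + D * x ^ v < 1"
    by (auto intro: order_tendstoD)
  then obtain N where N: "\<And>v. v \<ge> N \<Longrightarrow> A * y ^ v + B * (real v * x ^ v) + D * x ^ v < 1"
    by (auto simp: eventually_sequentially)
  define C where "C = (\<Sum>v<N. \<bar>f v\<bar>)"
  have "f v \<le> 2 powr (b * v) + C" for v
  proof (cases "v < N")
    case True
    then have "\<bar>f v\<bar> \<le> C" unfolding C_def by (intro member_le_sum) auto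
    then show ?thesis by (smt (verit) powr_ge_zero)
  next
    case False
    have "x ^ v * 2 powr (b * v) = 1" "y ^ v * 2 powr (b * v) = 2 powr (a * v)"
      by (simp_all add: x_def y_def powr_power algebra_simps flip: powr_add)
    then have "f v = (A * y ^ v + B * (real v * x ^ v) + D * x ^ v) * 2 powr (b * v)"
      unfolding f_def by (simp add: distrib_right mult.assoc)
    also have "\<dots> \<le> 1 * 2 powr (b * v)" using N[of v] False by (intro mult_right_mono) auto
    also have "\<dots> \<le> 2 powr (b * v) + C" by (simp add: C_def sum_nonneg)
    finally show ?thesis .
  qed
  moreover have "C \<ge> 0" by (simp add: C_def sum_nonneg)
  ultimately show thesis using that unfolding f_def by blast
qed

lemma spread_in_SC:
  assumes U: "universal U" and "0 < \<alpha>" and q: "(real q + 1) * \<alpha> < real q * \<beta>"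
    and X: "X \<in> COMPLEX U (\<lambda>n. real n powr \<beta>)"
  shows "(\<lambda>p. X (spread q p)) \<in> SC U (\<lambda>n. real n powr \<alpha>)"
proof -
  let ?Y = "\<lambda>p. X (spread q p)"
  obtain c where c: "\<And>n. real (K U (restr X n)) \<ge> real n powr \<beta> - real c"
    using X unfolding COMPLEX_def by auto
  obtain d where d: "\<And>s n v. 2 ^ wexp q v \<le> n \<Longrightarrow> K U (restr X (2 ^ (q * v)))
      \<le> K U (map ?Y [s..<s + n]) + Suc v + wexp q v + d"
    using K_prefix_le_K_window[OF U] by metis
  \<comment> \<open>The first factor comes from \<open>wexp q (Suc v) = (q + 1) * v + q + 2\<close>;
    the linear term and 2 are the cost \<open>Suc v + wexp q v\<close>.\<close>
  obtain C where "C \<ge> 0" and C: "\<And>v::nat. 2 powr ((real q + 2) * \<alpha>) * 2 powr ((real q + 1) * \<alpha> * v)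
      + (real q + 2) * v + 2 \<le> 2 powr (real q * \<beta> * v) + C"
    using exponential_dominates[of "(real q + 1) * \<alpha>" "real q * \<beta>"] \<open>0 < \<alpha>\<close> q
    by (metis add_nonneg_pos mult_pos_pos of_nat_0_le_iff zero_less_one)
  \<comment> \<open>The extra 1 serves windows with \<open>n < 2\<close>: these admit no
    \<open>v\<close>, since \<open>2 ^ wexp q 0 = 2\<close>.\<close>
  define e where "e = nat \<lceil>c + d + C + 1\<rceil>"
  have e: "real e \<ge> c + d + C + 1" unfolding e_def by linarith
  have "real n powr \<alpha> - real e \<le> real (K U (map ?Y [s..<s + n]))" for s n
  proof (cases "n < 2")
    case True
    then have "real n powr \<alpha> \<le> 1" using \<open>0 < \<alpha>\<close> by (intro powr_le1) auto
    then show ?thesis using e \<open>C \<ge> 0\<close> by linarith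
  next
    case False
    \<comment> \<open>Exponential growth bounds the admissible \<open>v\<close>, so a largest one
      exists.\<close>
    have "n < 2 ^ n" by (rule less_exp)
    also have "\<dots> \<le> 2 ^ wexp q n" by (intro power_increasing) (auto simp: wexp_def)
    finally obtain v where v: "\<forall>i\<le>v. \<not> n < 2 ^ wexp q i" "n < 2 ^ wexp q (Suc v)"
      using ex_least_nat_less[of "\<lambda>v. n < 2 ^ wexp q v" n] False by (auto simp: wexp_def)
    have "real (2 ^ (q * v)) powr \<beta> = 2 powr (real q * \<beta> * v)"
      by (simp add: powr_powr mult_ac flip: powr_realpow)
    with c[of "2 ^ (q * v)"] d[of v n s] v(1)
    have K: "2 powr (real q * \<beta> * v) \<le> K U (map ?Y [s..<s + n]) + Suc v + wexp q v + d + c"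
      by (auto simp: not_less)
    have "real n \<le> real (2 ^ wexp q (Suc v))" using v(2) by (intro of_nat_mono) simp
    then have "real n powr \<alpha> \<le> real (2 ^ wexp q (Suc v)) powr \<alpha>"
      using \<open>0 < \<alpha>\<close> by (intro powr_mono2) auto
    also have "\<dots> = 2 powr (real (wexp q (Suc v)) * \<alpha>)"
      by (simp add: powr_powr flip: powr_realpow)
    also have "\<dots> = 2 powr ((real q + 2) * \<alpha>) * 2 powr ((real q + 1) * \<alpha> * v)"
      by (simp add: wexp_def algebra_simps flip: powr_add)
    finally have "real n powr \<alpha> + (real q + 2) * v + 2 \<le> 2 powr (real q * \<beta> * v) + C"
      using C[of v] by linarith
    with K e show ?thesis by (simp add: wexp_def algebra_simps)
  qed
  moreover have "\<exists>s n. \<tau> = map ?Y [s..<s + n] \<and> n = length \<tau>" if \<tau>: "substring_of \<tau> ?Y" for \<tau>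
  proof -
    obtain i j where "\<tau> = map ?Y [i..<j]" using \<tau> unfolding substring_of_def by blast
    \<comment> \<open>Truncated subtraction covers \<open>j < i\<close>, where the substring is
      empty.\<close>
    then have "\<tau> = map ?Y [i..<i + (j - i)] \<and> j - i = length \<tau>" by (cases "i \<le> j") auto
    then show ?thesis by blast
  qed
  ultimately have "real (length \<tau>) powr \<alpha> - real e \<le> real (K U \<tau>)"
    if "substring_of \<tau> ?Y" for \<tau>
    using that by metis
  then show ?thesis unfolding SC_def by blast
qed

section \<open>The reduction as a functional\<close>

text \<open>Each output takes a single query at a computed position, so the functional is defined
  everywhere.\<close>

lemma partial_recursive_functional_comp:
  assumes "totrec 1 (\<lambda>xs. g (xs ! 0))"
  shows "partial_recursive_functional (\<lambda>X. Some (\<lambda>n. X (g n)))"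
proof -
  obtain e where e: "\<And>X n. computes X e [n] (g n)"
    using assms unfolding totrec_def by (metis One_nat_def length_Cons list.size(3) nth_Cons_0)
  have "computes X (Comp Query [e]) [n] (X (g n))" for X n
    by (rule computes.Comp[where ys = "[g n]"]) (simp_all add: e computes.Query)
  then have "computes X (Comp Query [e]) [n] y \<longleftrightarrow> X (g n) = y" for X n y
    using computes_deterministic by blast
  then show ?thesis
    unfolding partial_recursive_functional_def by (intro exI[of _ "Comp Query [e]"]) auto
qed

theorem mainTheorem16:
  fixes U :: "bool list \<Rightarrow> bool list option" and \<alpha> \<beta> :: rat
  assumes "universal U" and "0 < \<alpha>" and "\<alpha> < \<beta>" and "\<beta> \<le> 1"
  shows "in_Baire (SC U (\<lambda>n. real n powr of_rat \<alpha>)) \<le>\<^sub>s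
         in_Baire (COMPLEX U (\<lambda>n. real n powr of_rat \<beta>))"
proof -
  have "0 < real_of_rat (\<beta> - \<alpha>)" using assms(3) by simp
  \<comment> \<open>The inequality rearranges to the growth condition of
    \<open>spread_in_SC\<close>; \<open>q\<close> depends only on the exponents, so one functional
    serves every \<open>X\<close>.\<close>
  then obtain q where "real_of_rat \<alpha> < real q * real_of_rat (\<beta> - \<alpha>)"
    using reals_Archimedean3 by blast
  then have q: "(real q + 1) * real_of_rat \<alpha> < real q * real_of_rat \<beta>"
    by (simp add: of_rat_diff algebra_simps)
  have "(\<lambda>n. of_bool (X (spread q n))) \<in> in_Baire (SC U (\<lambda>n. real n powr of_rat \<alpha>))"
    if "X \<in> COMPLEX U (\<lambda>n. real n powr of_rat \<beta>)" for X
    unfolding in_Baire_def using spread_in_SC[OF assms(1) _ q that] assms(2)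
    by (intro image_eqI[where x = "\<lambda>n. X (spread q n)"]) simp_all
  then show ?thesis
    unfolding strongly_reducible_def
    by (intro exI[of _ "\<lambda>X. Some (\<lambda>n. X (spread q n))"] conjI
        partial_recursive_functional_comp totrec_spread) (auto simp: in_Baire_def)
qed

end
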